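(* Let $f:(\mathbb{R}^3,0)\to(\mathbb{R}^2,0)$ be a $C^\infty$ map-germ which is a cusp at $0$, let $D_1$ be a rank $2$ tangent distribution on a neighborhood of $0$ in $\mathbb{R}^3$, and let $\varphi:D_1\to f^*T\mathbb{R}^2$, $\varphi(v)=df(v)$, be the bundle homomorphism induced by $f$. Assume $\operatorname{rank}\varphi_0=1$. If $0$ is a non-degenerate singular point of $\varphi$ and is not fold-like, then $0$ is a cusp-like singular point of $\varphi$.
   Context: Two map-germs $f,g:(\mathbb{R}^m,0)\to(\mathbb{R}^n,0)$ are $\mathcal{A}$-equivalent if there exist diffeomorphism-germs $\sigma$ of $(\mathbb{R}^m,0)$ and $\tau$ of $(\mathbb{R}^n,0)$ with $\tau\circ f\circ\sigma^{-1}=g$. The germ $f:(\mathbb{R}^3,0)\to(\mathbb{R}^2,0)$ is a cusp at $0$ if it is $\mathcal{A}$-equivalent to $(u,v,w)\mapsto(u,v^2+w^3+uw)$ at $0$. For a frame $\{e_1,e_2\}$ of $D_1$, put $\lambda_\varphi=\det(e_1f,e_2f)$; the singular set of $\varphi$ (points where $\operatorname{rank}\varphi_p<2$) is $S=\{\lambda_\varphi=0\}$. A singular point $p$ is of corank one if $\operatorname{rank}\varphi_p=1$, and non-degenerate if $d\lambda_\varphi(p)\ne0$. A null section of $\varphi$ near a corank one singular point $p$ is a smooth section $\eta_\varphi$ of $D_1$ on a neighborhood $U$ of $p$ such that $(\eta_\varphi)_q$ generates $\ker\varphi_q$ for all $q\in S\cap U$. A singular point $p$ is fold-like if it is of corank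 one and $\eta_\varphi\lambda_\varphi(p)\ne0$; it is cusp-like if it is non-degenerate, $\eta_\varphi\lambda_\varphi(p)=0$ and $\eta_\varphi^2\lambda_\varphi(p)\ne0$ (iterated directional derivatives). These notions do not depend on the choices of frame and null section. *)

theory Defs
  imports "HOL-Analysis.Analysis"
begin

text \<open>Smoothness is only ever used on open sets, where \<open>at x\<close> is the right filter.\<close>

primrec Ck_on ::
  "nat \<Rightarrow> ('a::euclidean_space \<Rightarrow> 'b::real_normed_vector) \<Rightarrow> 'a set \<Rightarrow> bool" where
  "Ck_on 0 f U \<longleftrightarrow> continuous_on U f"
| "Ck_on (Suc k) f U \<longleftrightarrow>
     (\<forall>x\<in>U. f differentiable (at x)) \<and>
     (\<forall>v. Ck_on k (\<lambda>x. frechet_derivative f (at x) v) U)"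

definition smooth_on ::
  "('a::euclidean_space \<Rightarrow> 'b::real_normed_vector) \<Rightarrow> 'a set \<Rightarrow> bool" where
  "smooth_on f U \<longleftrightarrow> (\<forall>k. Ck_on k f U)"

text \<open>A germ is given by a representative, a total function of which only the values near
  the base point \<open>0\<close> matter.\<close>

definition smooth_germ :: "('a::euclidean_space \<Rightarrow> 'b::real_normed_vector) \<Rightarrow> bool" where
  "smooth_germ f \<longleftrightarrow> f 0 = 0 \<and> (\<exists>U. open U \<and> 0 \<in> U \<and> smooth_on f U)"

text \<open>\<open>\<sigma>\<close> is a diffeomorphism-germ whose inverse is the germ of \<open>\<sigma>'\<close>.\<close>

definition diffeo_germ ::
  "('a::euclidean_space \<Rightarrow> 'a) \<Rightarrow> ('a \<Rightarrow> 'a) \<Rightarrow> bool" where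
  "diffeo_germ \<sigma> \<sigma>' \<longleftrightarrow> smooth_germ \<sigma> \<and> smooth_germ \<sigma>' \<and>
     (\<forall>\<^sub>F x in nhds 0. \<sigma>' (\<sigma> x) = x) \<and> (\<forall>\<^sub>F y in nhds 0. \<sigma> (\<sigma>' y) = y)"

definition A_equivalent ::
  "('a::euclidean_space \<Rightarrow> 'b::euclidean_space) \<Rightarrow> ('a \<Rightarrow> 'b) \<Rightarrow> bool" where
  "A_equivalent f g \<longleftrightarrow>
     (\<exists>\<sigma> \<sigma>' \<tau> \<tau>'. diffeo_germ \<sigma> \<sigma>' \<and> diffeo_germ \<tau> \<tau>' \<and>
        (\<forall>\<^sub>F x in nhds 0. (\<tau> \<circ> f \<circ> \<sigma>') x = g x))"

definition cusp_normal_form :: "real^3 \<Rightarrow> real^2" where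
  "cusp_normal_form x = vector [x$1, (x$2)^2 + (x$3)^3 + x$1 * x$3]"

definition cusp_germ :: "(real^3 \<Rightarrow> real^2) \<Rightarrow> bool" where
  "cusp_germ f \<longleftrightarrow> A_equivalent f cusp_normal_form"

text \<open>A distribution assigns to a point \<open>q\<close> a subspace \<open>D q\<close> of the tangent space at \<open>q\<close>,
  which is identified with \<open>\<real>\<^sup>3\<close>.\<close>

definition frame_on ::
  "(real^3) set \<Rightarrow> (real^3 \<Rightarrow> (real^3) set) \<Rightarrow> (real^3 \<Rightarrow> real^3) \<Rightarrow> (real^3 \<Rightarrow> real^3) \<Rightarrow> bool" where
  "frame_on V D e1 e2 \<longleftrightarrow> open V \<and> smooth_on e1 V \<and> smooth_on e2 V \<and>
     (\<forall>q\<in>V. e1 q \<noteq> e2 q \<and> independent {e1 q, e2 q} \<and> D q = span {e1 q, e2 q})"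

definition rank2_distribution_on :: "(real^3) set \<Rightarrow> (real^3 \<Rightarrow> (real^3) set) \<Rightarrow> bool" where
  "rank2_distribution_on U D \<longleftrightarrow> open U \<and>
     (\<forall>q\<in>U. \<exists>V e1 e2. q \<in> V \<and> V \<subseteq> U \<and> frame_on V D e1 e2)"

definition dir_deriv ::
  "(real^3 \<Rightarrow> real^3) \<Rightarrow> (real^3 \<Rightarrow> 'b::real_normed_vector) \<Rightarrow> real^3 \<Rightarrow> 'b" where
  "dir_deriv X h q = frechet_derivative h (at q) (X q)"

text \<open>The homomorphism \<open>\<phi>\<close> induced by \<open>f\<close> is the restriction of \<open>df\<close> to \<open>D\<close>, so it is
  determined by the pair \<open>f\<close>, \<open>D\<close>.\<close>

definition phi_rank :: "(real^3 \<Rightarrow> real^2) \<Rightarrow> (real^3 \<Rightarrow> (real^3) set) \<Rightarrow> real^3 \<Rightarrow> nat" where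
  "phi_rank f D q = dim (frechet_derivative f (at q) ` D q)"

definition phi_kernel ::
  "(real^3 \<Rightarrow> real^2) \<Rightarrow> (real^3 \<Rightarrow> (real^3) set) \<Rightarrow> real^3 \<Rightarrow> (real^3) set" where
  "phi_kernel f D q = {v \<in> D q. frechet_derivative f (at q) v = 0}"

definition singular_point :: "(real^3 \<Rightarrow> real^2) \<Rightarrow> (real^3 \<Rightarrow> (real^3) set) \<Rightarrow> real^3 \<Rightarrow> bool" where
  "singular_point f D p \<longleftrightarrow> phi_rank f D p < 2"

definition corank_one :: "(real^3 \<Rightarrow> real^2) \<Rightarrow> (real^3 \<Rightarrow> (real^3) set) \<Rightarrow> real^3 \<Rightarrow> bool" where
  "corank_one f D p \<longleftrightarrow> phi_rank f D p = 1"

definition lambda_phi ::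
  "(real^3 \<Rightarrow> real^2) \<Rightarrow> (real^3 \<Rightarrow> real^3) \<Rightarrow> (real^3 \<Rightarrow> real^3) \<Rightarrow> real^3 \<Rightarrow> real" where
  "lambda_phi f e1 e2 q = det (transpose (vector [dir_deriv e1 f q, dir_deriv e2 f q] :: real^2^2))"

definition null_section_on ::
  "(real^3) set \<Rightarrow> (real^3 \<Rightarrow> real^2) \<Rightarrow> (real^3 \<Rightarrow> (real^3) set) \<Rightarrow> (real^3 \<Rightarrow> real^3) \<Rightarrow> bool" where
  "null_section_on W f D \<eta> \<longleftrightarrow> open W \<and> smooth_on \<eta> W \<and> (\<forall>q\<in>W. \<eta> q \<in> D q) \<and>
     (\<forall>q\<in>W. singular_point f D q \<longrightarrow> phi_kernel f D q = span {\<eta> q})"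

text \<open>The following notions do not depend on the choice of the frame and the null section, so
  they are stated for some choice.\<close>

definition nondegenerate_singular ::
  "(real^3 \<Rightarrow> real^2) \<Rightarrow> (real^3 \<Rightarrow> (real^3) set) \<Rightarrow> real^3 \<Rightarrow> bool" where
  "nondegenerate_singular f D p \<longleftrightarrow> singular_point f D p \<and>
     (\<exists>V e1 e2. p \<in> V \<and> frame_on V D e1 e2 \<and>
        frechet_derivative (lambda_phi f e1 e2) (at p) \<noteq> (\<lambda>v. 0))"

definition fold_like :: "(real^3 \<Rightarrow> real^2) \<Rightarrow> (real^3 \<Rightarrow> (real^3) set) \<Rightarrow> real^3 \<Rightarrow> bool" where
  "fold_like f D p \<longleftrightarrow> corank_one f D p \<and>
     (\<exists>V e1 e2 W \<eta>. p \<in> V \<and> frame_on V D e1 e2 \<and> p \<in> W \<and> null_section_on W f D \<eta> \<and>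
        dir_deriv \<eta> (lambda_phi f e1 e2) p \<noteq> 0)"

definition cusp_like :: "(real^3 \<Rightarrow> real^2) \<Rightarrow> (real^3 \<Rightarrow> (real^3) set) \<Rightarrow> real^3 \<Rightarrow> bool" where
  "cusp_like f D p \<longleftrightarrow> corank_one f D p \<and> nondegenerate_singular f D p \<and>
     (\<exists>V e1 e2 W \<eta>. p \<in> V \<and> frame_on V D e1 e2 \<and> p \<in> W \<and> null_section_on W f D \<eta> \<and>
        dir_deriv \<eta> (lambda_phi f e1 e2) p = 0 \<and>
        dir_deriv \<eta> (dir_deriv \<eta> (lambda_phi f e1 e2)) p \<noteq> 0)"

end

theory Submission
  imports Defs
begin

text \<open>Near \<open>0\<close> write \<open>f = \<psi> \<circ> h\<close> with \<open>h = (u, v\<^sup>2 + w\<^sup>3 + u w)\<close>, where \<open>\<psi>\<close> is a local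
  diffeomorphism of the plane and \<open>(u, v, w)\<close> are local coordinates of the source. The section
  \<open>\<eta> = (e\<^sub>2 u) e\<^sub>1 - (e\<^sub>1 u) e\<^sub>2\<close> of \<open>D\<^sub>1\<close> satisfies \<open>\<eta> u = 0\<close>, and
  \<open>\<lambda> = c \<cdot> \<eta> (v\<^sup>2 + w\<^sup>3 + u w)\<close> with \<open>c = - det d\<psi> \<noteq> 0\<close>; hence \<open>\<eta>\<close> is a null section where it
  does not vanish, in particular near \<open>0\<close>, because \<open>\<phi>\<^sub>0\<close> has rank one. The Leibniz rule gives
  \<open>\<eta> \<lambda> (0) = 2 c (\<eta> v)\<^sup>2\<close>, so if \<open>0\<close> is not fold-like then \<open>\<eta> v (0) = 0\<close>, and then
  \<open>\<eta>\<^sup>2 \<lambda> (0) = 6 c (\<eta> w)\<^sup>3\<close>. This is not zero, since \<open>\<eta> u\<close> and \<open>\<eta> v\<close> vanish at \<open>0\<close> and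
  \<open>\<eta>\<close> does not.\<close>

section \<open>Smooth functions and directional derivatives\<close>

lemma Ck_on_cong:
  assumes "open U" "\<And>x. x \<in> U \<Longrightarrow> f x = g x" "Ck_on k f U"
  shows "Ck_on k g U"
  using assms(2,3)
proof (induction k arbitrary: f g)
  case 0
  then show ?case by (simp cong: continuous_on_cong)
next
  case (Suc k)
  have d: "f differentiable (at x)" if "x \<in> U" for x
    using Suc.prems that by simp
  have "g differentiable (at x)" if "x \<in> U" for x
    using d[OF that] has_derivative_transform_within_open[where f = f and g = g, OF _ \<open>open U\<close> that Suc.prems(1)]
    unfolding differentiable_def by blast
  moreover have "frechet_derivative f (at x) = frechet_derivative g (at x)" if "x \<in> U" for x
    using frechet_derivative_transform_within_open[OF d[OF that] \<open>open U\<close> that Suc.prems(1)] .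
  then have "Ck_on k (\<lambda>x. frechet_derivative g (at x) v) U" for v
    using Suc.IH[of "\<lambda>x. frechet_derivative f (at x) v"] Suc.prems(2) by simp
  ultimately show ?case by simp
qed

text \<open>\<open>frechet_derivative\<close> is defined by choice, so the class of a concrete map
  is computed from any formula \<open>f'\<close> for its derivative, and uniqueness of derivatives
  on an open set transfers the result. The inductive closure proofs below rest on this.\<close>

lemma Ck_on_SucI:
  assumes "open U" "\<And>x. x \<in> U \<Longrightarrow> (f has_derivative f' x) (at x)"
    and "\<And>v. Ck_on k (\<lambda>x. f' x v) U"
  shows "Ck_on (Suc k) f U"
proof -
  have "f' x v = frechet_derivative f (at x) v" if "x \<in> U" for x v
    using frechet_derivative_at[OF assms(2)[OF that]] by simp
  then have "Ck_on k (\<lambda>x. frechet_derivative f (at x) v) U" for v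
    by (rule Ck_on_cong[OF \<open>open U\<close> _ assms(3)])
  then show ?thesis
    using assms(2) by (auto simp: differentiable_def)
qed

lemma Ck_on_Suc_has_derivative:
  assumes "Ck_on (Suc k) f U" "x \<in> U"
  shows "(f has_derivative frechet_derivative f (at x)) (at x)"
  using assms by (simp add: frechet_derivative_works)

text \<open>The product and chain rules keep undifferentiated factors, which are then required in
  the lower class. The base case is that differentiability implies continuity; the step applies the
  induction hypothesis to the directional derivatives.\<close>

lemma Ck_on_SucD: "Ck_on (Suc k) f U \<Longrightarrow> Ck_on k f U"
proof (induction k arbitrary: f)
  case 0
  then show ?case
    by (auto intro!: continuous_at_imp_continuous_on differentiable_imp_continuous_within)
next
  case (Suc k)
  note * = Suc.prems[unfolded Ck_on.simps(2)[of "Suc k"]]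
  have "Ck_on k (\<lambda>x. frechet_derivative f (at x) v) U" for v
    using * by (intro Suc.IH) simp
  with * show ?case by simp
qed

lemma Ck_on_subset: "Ck_on k f U \<Longrightarrow> V \<subseteq> U \<Longrightarrow> Ck_on k f V"
proof (induction k arbitrary: f)
  case 0
  then show ?case by (auto intro: continuous_on_subset)
next
  case (Suc k)
  then show ?case by (simp add: subset_eq)
qed

lemma Ck_on_const: "Ck_on k (\<lambda>x. c) U"
  by (induction k arbitrary: c) simp_all

lemma Ck_on_bounded_linear:
  assumes "bounded_linear L" "open U" "Ck_on k f U"
  shows "Ck_on k (\<lambda>x. L (f x)) U"
  using assms(3)
proof (induction k arbitrary: f)
  case 0
  then show ?case using assms(1) by (simp add: bounded_linear.continuous_on)
next
  case (Suc k)
  show ?case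
  proof (rule Ck_on_SucI[OF \<open>open U\<close>])
    show "((\<lambda>x. L (f x)) has_derivative (\<lambda>v. L (frechet_derivative f (at x) v))) (at x)"
      if "x \<in> U" for x
      by (rule bounded_linear.has_derivative[OF assms(1) Ck_on_Suc_has_derivative[OF Suc.prems that]])
    show "Ck_on k (\<lambda>x. L (frechet_derivative f (at x) v)) U" for v
      using Suc.IH Suc.prems by simp
  qed
qed

lemma Ck_on_add:
  assumes "open U" "Ck_on k f U" "Ck_on k g U"
  shows "Ck_on k (\<lambda>x. f x + g x) U"
  using assms(2,3)
proof (induction k arbitrary: f g)
  case 0
  then show ?case by (simp add: continuous_on_add)
next
  case (Suc k)
  show ?case
  proof (rule Ck_on_SucI[OF \<open>open U\<close>])
    show "((\<lambda>x. f x + g x) has_derivative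
        (\<lambda>v. frechet_derivative f (at x) v + frechet_derivative g (at x) v)) (at x)"
      if "x \<in> U" for x
      by (intro has_derivative_add Ck_on_Suc_has_derivative[OF _ that]) (rule Suc.prems)+
    show "Ck_on k (\<lambda>x. frechet_derivative f (at x) v + frechet_derivative g (at x) v) U" for v
      using Suc.IH Suc.prems by simp
  qed
qed

lemma Ck_on_sum:
  assumes "open U" "\<And>i. i \<in> I \<Longrightarrow> Ck_on k (f i) U"
  shows "Ck_on k (\<lambda>x. \<Sum>i\<in>I. f i x) U"
  using assms(2)
  by (induction I rule: infinite_finite_induct) (auto intro: Ck_on_const Ck_on_add \<open>open U\<close>)

lemma Ck_on_bounded_bilinear:
  assumes "bounded_bilinear B" "open U" "Ck_on k f U" "Ck_on k g U"
  shows "Ck_on k (\<lambda>x. B (f x) (g x)) U"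
  using assms(3,4)
proof (induction k arbitrary: f g)
  case 0
  then show ?case using assms(1) by (simp add: bounded_bilinear.continuous_on)
next
  case (Suc k)
  show ?case
  proof (rule Ck_on_SucI[OF \<open>open U\<close>])
    show "((\<lambda>x. B (f x) (g x)) has_derivative
        (\<lambda>v. B (f x) (frechet_derivative g (at x) v) + B (frechet_derivative f (at x) v) (g x))) (at x)"
      if "x \<in> U" for x
      by (intro bounded_bilinear.FDERIV[OF assms(1)] Ck_on_Suc_has_derivative[OF _ that])
        (rule Suc.prems)+
    show "Ck_on k (\<lambda>x. B (f x) (frechet_derivative g (at x) v) + B (frechet_derivative f (at x) v) (g x)) U"
      for v
      using Suc.IH Ck_on_SucD[OF Suc.prems(1)] Ck_on_SucD[OF Suc.prems(2)] Suc.prems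
      by (intro Ck_on_add \<open>open U\<close>) simp_all
  qed
qed

text \<open>Expanding \<open>X x\<close> in the standard basis turns \<open>F x (X x)\<close> into a
  finite sum of coordinates times \<open>F x b\<close>. This bridges derivatives in a fixed
  direction, which \<open>Ck_on\<close> controls, and derivatives along a varying vector, as in the
  chain rule and in \<open>dir_deriv\<close>.\<close>

lemma Ck_on_linear_apply:
  fixes F :: "'a::euclidean_space \<Rightarrow> 'b::euclidean_space \<Rightarrow> 'c::real_normed_vector"
  assumes "open U" "\<And>x. x \<in> U \<Longrightarrow> linear (F x)" "\<And>b. Ck_on k (\<lambda>x. F x b) U" "Ck_on k X U"
  shows "Ck_on k (\<lambda>x. F x (X x)) U"
proof (rule Ck_on_cong[OF \<open>open U\<close>])
  show "Ck_on k (\<lambda>x. \<Sum>b\<in>Basis. (X x \<bullet> b) *\<^sub>R F x b) U"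
    by (intro Ck_on_sum \<open>open U\<close> Ck_on_bounded_bilinear[OF bounded_bilinear_scaleR] assms(3)
        Ck_on_bounded_linear[OF bounded_linear_inner_left] assms(4))
  show "(\<Sum>b\<in>Basis. (X x \<bullet> b) *\<^sub>R F x b) = F x (X x)" if "x \<in> U" for x
  proof -
    interpret linear "F x" by (rule assms(2)[OF that])
    show ?thesis
      by (subst (2) euclidean_representation[symmetric]) (simp add: sum scale)
  qed
qed

text \<open>Induction with \<open>g\<close> generalized: for fixed \<open>b\<close>, the coefficient
  of the chain rule is again a composite with \<open>f\<close>, its outer map being the derivative
  of \<open>g\<close> in the direction \<open>b\<close>, of one class less.\<close>

lemma Ck_on_compose:
  fixes f :: "'a::euclidean_space \<Rightarrow> 'b::euclidean_space" and g :: "'b \<Rightarrow> 'c::real_normed_vector"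
  assumes "open U" "f ` U \<subseteq> V" "Ck_on k g V" "Ck_on k f U"
  shows "Ck_on k (\<lambda>x. g (f x)) U"
  using assms(3,4)
proof (induction k arbitrary: g)
  case 0
  then show ?case using assms(2) by (simp add: continuous_on_compose2)
next
  case (Suc k)
  have V: "f x \<in> V" if "x \<in> U" for x
    using assms(2) that by blast
  show ?case
  proof (rule Ck_on_SucI[OF \<open>open U\<close>])
    show "((\<lambda>x. g (f x)) has_derivative
        (\<lambda>v. frechet_derivative g (at (f x)) (frechet_derivative f (at x) v))) (at x)"
      if "x \<in> U" for x
      using has_derivative_compose[OF Ck_on_Suc_has_derivative[OF Suc.prems(2) that]
          Ck_on_Suc_has_derivative[OF Suc.prems(1) V[OF that]]] .
    show "Ck_on k (\<lambda>x. frechet_derivative g (at (f x)) (frechet_derivative f (at x) v)) U" for v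
    proof (rule Ck_on_linear_apply[OF \<open>open U\<close>])
      show "linear (frechet_derivative g (at (f x)))" if "x \<in> U" for x
        using Suc.prems(1) V[OF that] by (simp add: linear_frechet_derivative)
      show "Ck_on k (\<lambda>x. frechet_derivative g (at (f x)) b) U" for b
        using Suc.prems by (intro Suc.IH Ck_on_SucD[OF Suc.prems(2)]) simp
      show "Ck_on k (\<lambda>x. frechet_derivative f (at x) v) U"
        using Suc.prems(2) by simp
    qed
  qed
qed

section \<open>Smooth maps on open sets\<close>

lemma smooth_on_has_derivative:
  "smooth_on f U \<Longrightarrow> x \<in> U \<Longrightarrow> (f has_derivative frechet_derivative f (at x)) (at x)"
  unfolding smooth_on_def by (rule Ck_on_Suc_has_derivative[where k = 0]) auto

lemma smooth_on_isCont: "smooth_on f U \<Longrightarrow> x \<in> U \<Longrightarrow> isCont f x"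
  using smooth_on_has_derivative has_derivative_continuous by blast

lemma smooth_on_isCont_nhds:
  "smooth_on f U \<Longrightarrow> x \<in> U \<Longrightarrow> filterlim f (nhds (f x)) (nhds x)"
  using smooth_on_isCont[of f U x] by (simp add: isCont_def tendsto_at_iff_tendsto_nhds)

lemma smooth_on_subset: "smooth_on f U \<Longrightarrow> V \<subseteq> U \<Longrightarrow> smooth_on f V"
  unfolding smooth_on_def by (simp add: Ck_on_subset[of _ f U])

lemma smooth_on_const: "smooth_on (\<lambda>x. c) U"
  unfolding smooth_on_def by (simp add: Ck_on_const)

lemma smooth_on_ident: "open U \<Longrightarrow> smooth_on (\<lambda>x. x) U"
  unfolding smooth_on_def
proof
  fix k assume "open U"
  then show "Ck_on k (\<lambda>x. x) U"
    by (cases k) (auto intro!: Ck_on_SucI has_derivative_ident Ck_on_const simp del: Ck_on.simps(2))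
qed

lemma smooth_on_bounded_linear:
  "bounded_linear L \<Longrightarrow> open U \<Longrightarrow> smooth_on f U \<Longrightarrow> smooth_on (\<lambda>x. L (f x)) U"
  unfolding smooth_on_def by (simp add: Ck_on_bounded_linear)

lemma smooth_on_nth: "open U \<Longrightarrow> smooth_on f U \<Longrightarrow> smooth_on (\<lambda>x. f x $ i) U"
  by (rule smooth_on_bounded_linear[OF bounded_linear_vec_nth])

lemma smooth_on_add:
  "open U \<Longrightarrow> smooth_on f U \<Longrightarrow> smooth_on g U \<Longrightarrow> smooth_on (\<lambda>x. f x + g x) U"
  unfolding smooth_on_def by (simp add: Ck_on_add)

lemma smooth_on_scaleR:
  "open U \<Longrightarrow> smooth_on f U \<Longrightarrow> smooth_on g U \<Longrightarrow> smooth_on (\<lambda>x. f x *\<^sub>R g x) U"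
  unfolding smooth_on_def by (simp add: Ck_on_bounded_bilinear[OF bounded_bilinear_scaleR])

lemma smooth_on_mult:
  fixes f g :: "'a::euclidean_space \<Rightarrow> real"
  shows "open U \<Longrightarrow> smooth_on f U \<Longrightarrow> smooth_on g U \<Longrightarrow> smooth_on (\<lambda>x. f x * g x) U"
  unfolding smooth_on_def by (simp add: Ck_on_bounded_bilinear[OF bounded_bilinear_mult])

lemma smooth_on_diff:
  assumes "open U" "smooth_on f U" "smooth_on g U"
  shows "smooth_on (\<lambda>x. f x - g x) U"
  using smooth_on_add[OF assms(1,2) smooth_on_bounded_linear[OF bounded_linear_minus[OF bounded_linear_ident] assms(1,3)]]
  by simp

lemma smooth_on_power:
  fixes f :: "'a::euclidean_space \<Rightarrow> real"
  shows "open U \<Longrightarrow> smooth_on f U \<Longrightarrow> smooth_on (\<lambda>x. f x ^ n) U"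
  by (induction n) (simp_all add: smooth_on_const smooth_on_mult)

lemmas smooth_on_intros =
  smooth_on_const smooth_on_add smooth_on_diff smooth_on_mult smooth_on_scaleR smooth_on_power smooth_on_nth

lemma smooth_on_compose:
  fixes f :: "'a::euclidean_space \<Rightarrow> 'b::euclidean_space"
  shows "open U \<Longrightarrow> f ` U \<subseteq> V \<Longrightarrow> smooth_on g V \<Longrightarrow> smooth_on f U \<Longrightarrow> smooth_on (\<lambda>x. g (f x)) U"
  unfolding smooth_on_def by (simp add: Ck_on_compose[of U f V])

lemma smooth_on_frechet_derivative:
  assumes "smooth_on f U"
  shows "smooth_on (\<lambda>x. frechet_derivative f (at x) v) U"
proof -
  have "Ck_on (Suc k) f U" for k
    using assms by (simp only: smooth_on_def)
  then show ?thesis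
    by (simp add: smooth_on_def)
qed

lemma smooth_on_dir_deriv:
  assumes "open U" "smooth_on X U" "smooth_on f U"
  shows "smooth_on (dir_deriv X f) U"
proof -
  have "linear (frechet_derivative f (at x))" if "x \<in> U" for x
    using smooth_on_has_derivative[OF assms(3) that] has_derivative_linear by blast
  then have "Ck_on k (\<lambda>q. frechet_derivative f (at q) (X q)) U" for k
    using assms(2) smooth_on_frechet_derivative[OF assms(3)] unfolding smooth_on_def
    by - (rule Ck_on_linear_apply[OF assms(1)]; simp)
  then show ?thesis
    unfolding smooth_on_def dir_deriv_def by blast
qed

section \<open>Calculus of directional derivatives\<close>

lemma dir_deriv_eqI: "(f has_derivative f') (at q) \<Longrightarrow> dir_deriv X f q = f' (X q)"
  unfolding dir_deriv_def using frechet_derivative_at by metis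

lemma dir_deriv_cong:
  assumes "open U" "q \<in> U" "\<And>x. x \<in> U \<Longrightarrow> f x = g x" "smooth_on f U"
  shows "dir_deriv X f q = dir_deriv X g q"
  using frechet_derivative_transform_within_open[OF _ assms(1,2,3)]
    smooth_on_has_derivative[OF assms(4,2)]
  unfolding dir_deriv_def differentiable_def by fastforce

lemma dir_deriv_add:
  "smooth_on f U \<Longrightarrow> smooth_on g U \<Longrightarrow> q \<in> U \<Longrightarrow>
    dir_deriv X (\<lambda>x. f x + g x) q = dir_deriv X f q + dir_deriv X g q"
  by (rule dir_deriv_eqI[THEN trans, OF has_derivative_add])
    (auto intro: smooth_on_has_derivative simp: dir_deriv_def)

lemma dir_deriv_mult:
  fixes f g :: "real^3 \<Rightarrow> real"
  shows "smooth_on f U \<Longrightarrow> smooth_on g U \<Longrightarrow> q \<in> U \<Longrightarrow>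
    dir_deriv X (\<lambda>x. f x * g x) q = f q * dir_deriv X g q + dir_deriv X f q * g q"
  by (rule dir_deriv_eqI[THEN trans, OF has_derivative_mult])
    (auto intro: smooth_on_has_derivative simp: dir_deriv_def)

lemma dir_deriv_power:
  fixes f :: "real^3 \<Rightarrow> real"
  shows "smooth_on f U \<Longrightarrow> q \<in> U \<Longrightarrow>
    dir_deriv X (\<lambda>x. f x ^ n) q = of_nat n * dir_deriv X f q * f q ^ (n - 1)"
  by (rule dir_deriv_eqI[THEN trans, OF has_derivative_power])
    (auto intro: smooth_on_has_derivative simp: dir_deriv_def)

lemma dir_deriv_const: "dir_deriv X (\<lambda>x. c) q = 0"
  by (rule dir_deriv_eqI[OF has_derivative_const])

lemma dir_deriv_nth:
  "smooth_on h U \<Longrightarrow> q \<in> U \<Longrightarrow> dir_deriv X (\<lambda>x. h x $ i) q = dir_deriv X h q $ i"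
  by (rule dir_deriv_eqI[THEN trans, OF bounded_linear.has_derivative[OF bounded_linear_vec_nth]])
    (auto intro: smooth_on_has_derivative simp: dir_deriv_def)

section \<open>Linear algebra in the plane\<close>

lemma det_columns_2: "det (transpose (vector [a, b] :: real^2^2)) = a $ 1 * b $ 2 - b $ 1 * a $ 2"
  by (simp add: det_2 transpose_def)

text \<open>Applying \<open>L\<close> to the columns multiplies the matrix by
  \<open>matrix L\<close> on the left. This splits the determinant of \<open>d\<psi>\<close> off
  from \<open>lambda_phi\<close>.\<close>

lemma det_columns_linear_image:
  fixes L :: "real^2 \<Rightarrow> real^2"
  assumes "linear L"
  shows "det (transpose (vector [L a, L b] :: real^2^2)) =
    det (matrix L) * det (transpose (vector [a, b] :: real^2^2))"
proof -
  have "L x = matrix L *v x" for x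
    using matrix_vector_mul(2)[OF assms] by (metis (no_types))
  from this[of a] this[of b]
  have "transpose (vector [L a, L b] :: real^2^2) = matrix L ** transpose (vector [a, b])"
    by (simp add: vec_eq_iff forall_2 transpose_def matrix_matrix_mult_def matrix_vector_mult_def sum_2)
  then show ?thesis by (simp add: det_mul)
qed

text \<open>Used in contrapositive form: where the rank is below 2, \<open>lambda_phi\<close>
  vanishes.\<close>

lemma dim_span_columns_2:
  fixes a b :: "real^2"
  assumes "det (transpose (vector [a, b] :: real^2^2)) \<noteq> 0"
  shows "dim (span {a, b}) = 2"
proof -
  define d where "d = a $ 1 * b $ 2 - b $ 1 * a $ 2"
  have d: "d \<noteq> 0" using assms unfolding det_columns_2 d_def .
  have "y \<in> span {a, b}" for y
  proof -
    \<comment> \<open>The coefficients are those of Cramer's rule.\<close>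
    have "y = ((y $ 1 * b $ 2 - b $ 1 * y $ 2) / d) *\<^sub>R a + ((a $ 1 * y $ 2 - y $ 1 * a $ 2) / d) *\<^sub>R b"
      using d by (simp add: vec_eq_iff forall_2 divide_simps) (simp add: d_def algebra_simps)
    then show ?thesis
      by (metis insertCI span_add span_base span_scale)
  qed
  then have "span {a, b} = UNIV" by blast
  then show ?thesis by simp
qed

lemma span_2_iff: "v \<in> span {a, b} \<longleftrightarrow> (\<exists>\<alpha> \<beta>. v = \<alpha> *\<^sub>R a + \<beta> *\<^sub>R b)"
  by (simp add: span_breakdown_eq span_singleton image_iff algebra_simps)

lemma independent_2_scaleR_eq:
  fixes a b :: "'a::real_vector"
  assumes "a \<noteq> b" "independent {a, b}" "s *\<^sub>R a = t *\<^sub>R b"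
  shows "s = 0 \<and> t = 0"
proof -
  have b: "b \<noteq> 0" and a: "a \<notin> span {b}"
    using assms(1,2) by (auto simp: independent_insert dest: dependent_zero)
  have "s = 0"
  proof (rule ccontr)
    assume "s \<noteq> 0"
    then have "a = (t / s) *\<^sub>R b"
      using assms(3) by (metis (no_types) divide_inverse_commute scaleR_scaleR scaleR_one left_inverse)
    then show False using a by (metis insertI1 span_base span_scale)
  qed
  then show ?thesis using b assms(3) by simp
qed

section \<open>The cusp\<close>

lemma dir_deriv_cusp_function:
  fixes u v w :: "real^3 \<Rightarrow> real"
  assumes N: "open N" "q \<in> N" "smooth_on u N" "smooth_on v N" "smooth_on w N"
    and Xu: "dir_deriv X u q = 0"
  shows "dir_deriv X (\<lambda>x. v x ^ 2 + w x ^ 3 + u x * w x) q =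
    2 * v q * dir_deriv X v q + (3 * w q ^ 2 + u q) * dir_deriv X w q"
  using N Xu
  by (simp add: dir_deriv_add[where U = N] dir_deriv_mult[where U = N] dir_deriv_power[where U = N]
      smooth_on_intros algebra_simps)

text \<open>With \<open>\<mu>\<close> the derivative of the cusp function along \<open>X\<close> and
  \<open>\<nu> = X \<mu>\<close>, one has \<open>\<Lambda> = c \<mu>\<close>. Derivatives of
  \<open>c\<close> disappear at \<open>p\<close>: in \<open>X \<Lambda>\<close> they come with
  \<open>\<mu> p = 0\<close>, and in the second derivative also with \<open>\<nu> p\<close>, which
  vanishes once \<open>X v\<close> does.\<close>

lemma dir_deriv_cusp_multiplier:
  fixes c u v w \<Lambda> :: "real^3 \<Rightarrow> real"
  assumes N: "open N" "p \<in> N"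
    and smooth: "smooth_on c N" "smooth_on u N" "smooth_on v N" "smooth_on w N" "smooth_on X N"
    and Xu: "\<And>q. q \<in> N \<Longrightarrow> dir_deriv X u q = 0"
    and zero: "u p = 0" "v p = 0" "w p = 0"
    and \<Lambda>: "\<And>q. q \<in> N \<Longrightarrow>
      \<Lambda> q = c q * dir_deriv X (\<lambda>x. v x ^ 2 + w x ^ 3 + u x * w x) q"
  shows "dir_deriv X \<Lambda> p = 2 * c p * dir_deriv X v p ^ 2"
    and "dir_deriv X v p = 0 \<Longrightarrow> dir_deriv X (dir_deriv X \<Lambda>) p = 6 * c p * dir_deriv X w p ^ 3"
proof -
  define a b where "a = dir_deriv X v" and "b = dir_deriv X w"
  define \<mu> where "\<mu> = (\<lambda>q. 2 * v q * a q + (3 * w q ^ 2 + u q) * b q)"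
  \<comment> \<open>This is \<open>\<mu>\<close> differentiated along \<open>X\<close> by the
    Leibniz rule, the terms with \<open>X u\<close> dropped because \<open>X u = 0\<close> on all of
    \<open>N\<close>.\<close>
  define \<nu> where "\<nu> = (\<lambda>q. 2 * a q ^ 2 + 2 * v q * dir_deriv X a q + 6 * w q * b q ^ 2
    + (3 * w q ^ 2 + u q) * dir_deriv X b q)"
  note s = smooth_on_intros smooth_on_dir_deriv N smooth
  have ab: "smooth_on a N" "smooth_on b N"
    unfolding a_def b_def by (intro s)+
  note d = dir_deriv_add[where U = N] dir_deriv_mult[where U = N] dir_deriv_power[where U = N]
    dir_deriv_const
  have \<mu>s: "smooth_on \<mu> N" and \<nu>s: "smooth_on \<nu> N"
    unfolding \<mu>_def \<nu>_def by (intro s ab)+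
  have \<mu>': "dir_deriv X \<mu> q = \<nu> q" if "q \<in> N" for q
    unfolding \<mu>_def \<nu>_def using that Xu[OF that]
    by (simp add: d s ab flip: a_def b_def) (simp add: algebra_simps power2_eq_square)
  have c\<mu>: "c q * \<mu> q = \<Lambda> q" if "q \<in> N" for q
    using \<Lambda> dir_deriv_cusp_function[OF N(1) that smooth(2-4) Xu[OF that]] that
    unfolding \<mu>_def a_def b_def by simp
  have \<Lambda>': "c q * \<nu> q + dir_deriv X c q * \<mu> q = dir_deriv X \<Lambda> q" if "q \<in> N" for q
  proof -
    have "dir_deriv X \<Lambda> q = dir_deriv X (\<lambda>x. c x * \<mu> x) q"
      using c\<mu> by (intro dir_deriv_cong[OF N(1) that, symmetric] s \<mu>s)
    then show ?thesis
      using \<mu>' that by (simp add: d s \<mu>s)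
  qed
  have \<mu>p: "\<mu> p = 0" and \<nu>p: "\<nu> p = 2 * a p ^ 2"
    using zero by (simp_all add: \<mu>_def \<nu>_def)
  show "dir_deriv X \<Lambda> p = 2 * c p * dir_deriv X v p ^ 2"
    using \<Lambda>'[OF N(2)] \<mu>p \<nu>p by (simp add: a_def)
  assume "dir_deriv X v p = 0"
  then have ap: "a p = 0" by (simp add: a_def)
  \<comment> \<open>Since \<open>u\<close>, \<open>v\<close>, \<open>w\<close>, \<open>a\<close> and
    \<open>X u\<close> vanish at \<open>p\<close>, the only surviving term of \<open>X \<nu>\<close>
    comes from differentiating the factor \<open>w\<close> in \<open>6 w b^2\<close>.\<close>
  have \<nu>'p: "dir_deriv X \<nu> p = 6 * b p ^ 3"
    unfolding \<nu>_def using N(2) Xu[OF N(2)] zero ap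
    by (simp add: d s ab flip: a_def b_def) (simp add: power3_eq_cube power2_eq_square)
  have "dir_deriv X (dir_deriv X \<Lambda>) p = dir_deriv X (\<lambda>q. c q * \<nu> q + dir_deriv X c q * \<mu> q) p"
    using \<Lambda>' by (intro dir_deriv_cong[OF N, symmetric] s \<mu>s \<nu>s)
  then show "dir_deriv X (dir_deriv X \<Lambda>) p = 6 * c p * dir_deriv X w p ^ 3"
    using N(2) \<mu>p \<nu>p \<nu>'p ap \<mu>'[OF N(2)] by (simp add: d s \<mu>s \<nu>s b_def)
qed

section \<open>Local factorization of \<open>f\<close> through the normal form\<close>

lemma diffeo_germ_sym: "diffeo_germ \<sigma> \<sigma>' \<Longrightarrow> diffeo_germ \<sigma>' \<sigma>"
  unfolding diffeo_germ_def by blast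

text \<open>Differentiating \<open>\<sigma>' (\<sigma> x) = x\<close> gives a left inverse of the
  derivative of \<open>\<sigma>\<close>. The neighborhood is shrunk so that this identity holds on
  it and \<open>\<sigma>\<close> maps it into the domain of \<open>\<sigma>'\<close>.\<close>

lemma diffeo_germ_immersion:
  assumes "diffeo_germ \<sigma> \<sigma>'"
  obtains N where "open N" "0 \<in> N" "smooth_on \<sigma> N"
    "\<And>x. x \<in> N \<Longrightarrow> inj (frechet_derivative \<sigma> (at x))"
proof -
  obtain U V where U: "open U" "0 \<in> U" "smooth_on \<sigma> U" "\<sigma> 0 = 0"
    and V: "open V" "0 \<in> V" "smooth_on \<sigma>' V"
    using assms unfolding diffeo_germ_def smooth_germ_def by metis
  have "\<forall>\<^sub>F x in nhds 0. \<sigma> x \<in> V"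
    using smooth_on_isCont_nhds[OF U(3,2)] U(4) eventually_nhds_in_open[OF V(1,2)]
    by (auto simp: filterlim_iff)
  moreover have "\<forall>\<^sub>F x in nhds 0. \<sigma>' (\<sigma> x) = x"
    using assms unfolding diffeo_germ_def by blast
  ultimately have "\<forall>\<^sub>F x in nhds 0. x \<in> U \<and> \<sigma> x \<in> V \<and> \<sigma>' (\<sigma> x) = x"
    using eventually_nhds_in_open[OF U(1,2)] by eventually_elim simp
  then obtain N where N: "open N" "0 \<in> N" "\<And>x. x \<in> N \<Longrightarrow> x \<in> U \<and> \<sigma> x \<in> V \<and> \<sigma>' (\<sigma> x) = x"
    unfolding eventually_nhds by blast
  show thesis
  proof (rule that[OF N(1,2)])
    show "smooth_on \<sigma> N" using smooth_on_subset[OF U(3)] N(3) by blast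
    fix x assume x: "x \<in> N"
    let ?A = "frechet_derivative \<sigma> (at x)" and ?B = "frechet_derivative \<sigma>' (at (\<sigma> x))"
    have "((\<lambda>x. \<sigma>' (\<sigma> x)) has_derivative (\<lambda>v. ?B (?A v))) (at x)"
      using N(3)[OF x] by (blast intro: has_derivative_compose smooth_on_has_derivative U V)
    then have "((\<lambda>x. x) has_derivative (\<lambda>v. ?B (?A v))) (at x)"
      by (rule has_derivative_transform_within_open[OF _ N(1) x]) (use N(3) in auto)
    then have "(\<lambda>v. ?B (?A v)) = (\<lambda>v. v)"
      using has_derivative_unique has_derivative_ident by blast
    then show "inj ?A" by (metis injI)
  qed
qed

definition cusp_height :: "real^3 \<Rightarrow> real" where
  "cusp_height y = (y$2)^2 + (y$3)^3 + y$1 * y$3"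

lemma cusp_normal_form_nth:
  "cusp_normal_form y $ 1 = y $ 1" "cusp_normal_form y $ 2 = cusp_height y"
  by (simp_all add: cusp_normal_form_def cusp_height_def)

lemma smooth_on_cusp_normal_form: "smooth_on cusp_normal_form UNIV"
proof -
  have "smooth_on (\<lambda>y::real^3. (y$1) *\<^sub>R axis 1 1 + ((y$2)^2 + (y$3)^3 + y$1 * y$3) *\<^sub>R (axis 2 1 :: real^2)) UNIV"
    by (intro smooth_on_intros smooth_on_ident open_UNIV)
  moreover have "(y$1) *\<^sub>R axis 1 1 + ((y$2)^2 + (y$3)^3 + y$1 * y$3) *\<^sub>R (axis 2 1 :: real^2)
      = cusp_normal_form y" for y
    by (simp add: vec_eq_iff forall_2 cusp_normal_form_nth cusp_height_def axis_def)
  ultimately show ?thesis by simp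
qed

text \<open>The relation \<open>\<tau> \<circ> f \<circ> \<sigma>' = cusp_normal_form\<close> is
  solved for \<open>f\<close>, with \<open>\<psi>\<close> being \<open>\<tau>'\<close>. Each germ
  identity is pulled back to the source along \<open>\<sigma>\<close>, \<open>f\<close> or the
  normal form, which are continuous at 0 and fix it; all of them then hold on a common
  \<open>N\<close>.\<close>

lemma cusp_germ_factorization:
  assumes "smooth_germ f" "cusp_germ f"
  obtains N \<sigma> T \<psi> where "open N" "0 \<in> N" "smooth_on \<sigma> N" "\<sigma> 0 = 0"
    "\<And>x. x \<in> N \<Longrightarrow> inj (frechet_derivative \<sigma> (at x))"
    "smooth_on \<psi> T" "\<And>y. y \<in> T \<Longrightarrow> inj (frechet_derivative \<psi> (at y))"
    "\<And>x. x \<in> N \<Longrightarrow> cusp_normal_form (\<sigma> x) \<in> T \<and> f x = \<psi> (cusp_normal_form (\<sigma> x))"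
proof -
  obtain \<sigma> \<sigma>' \<tau> \<tau>' where d: "diffeo_germ \<sigma> \<sigma>'" "diffeo_germ \<tau> \<tau>'"
    and eq: "\<forall>\<^sub>F y in nhds 0. (\<tau> \<circ> f \<circ> \<sigma>') y = cusp_normal_form y"
    using assms(2) unfolding cusp_germ_def A_equivalent_def by blast
  obtain M where M: "open M" "0 \<in> M" "smooth_on \<sigma> M"
    "\<And>x. x \<in> M \<Longrightarrow> inj (frechet_derivative \<sigma> (at x))"
    using diffeo_germ_immersion[OF d(1)] by blast
  obtain T where T: "open T" "0 \<in> T" "smooth_on \<tau>' T"
    "\<And>x. x \<in> T \<Longrightarrow> inj (frechet_derivative \<tau>' (at x))"
    using diffeo_germ_immersion[OF diffeo_germ_sym[OF d(2)]] by blast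
  have \<sigma>0: "\<sigma> 0 = 0"
    using d(1) unfolding diffeo_germ_def smooth_germ_def by blast
  have \<sigma>lim: "filterlim \<sigma> (nhds 0) (nhds 0)"
    using smooth_on_isCont_nhds[OF M(3,2)] \<sigma>0 by simp
  have flim: "filterlim f (nhds 0) (nhds 0)"
    using assms(1) smooth_on_isCont_nhds[of f _ 0] unfolding smooth_germ_def by auto
  have "cusp_normal_form 0 = 0"
    by (simp add: vec_eq_iff forall_2 cusp_normal_form_nth cusp_height_def)
  then have "filterlim cusp_normal_form (nhds 0) (nhds 0)"
    using smooth_on_isCont_nhds[OF smooth_on_cusp_normal_form, of 0] by simp
  then have "\<forall>\<^sub>F y in nhds 0. cusp_normal_form y \<in> T"
    using eventually_nhds_in_open[OF T(1,2)] by (auto simp: filterlim_iff)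
  then have "\<forall>\<^sub>F x in nhds 0. cusp_normal_form (\<sigma> x) \<in> T"
    by (rule eventually_compose_filterlim[OF _ \<sigma>lim])
  moreover have "\<forall>\<^sub>F x in nhds 0. (\<tau> \<circ> f \<circ> \<sigma>') (\<sigma> x) = cusp_normal_form (\<sigma> x)"
    by (rule eventually_compose_filterlim[OF eq \<sigma>lim])
  moreover have "\<forall>\<^sub>F x in nhds 0. \<sigma>' (\<sigma> x) = x"
    using d(1) unfolding diffeo_germ_def by blast
  moreover have "\<forall>\<^sub>F x in nhds 0. \<tau>' (\<tau> (f x)) = f x"
    using d(2) unfolding diffeo_germ_def
    by (intro eventually_compose_filterlim[where F = "nhds 0", OF _ flim]) blast
  ultimately have "\<forall>\<^sub>F x in nhds 0. x \<in> M \<and> cusp_normal_form (\<sigma> x) \<in> T \<and>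
      f x = \<tau>' (cusp_normal_form (\<sigma> x))"
    using eventually_nhds_in_open[OF M(1,2)] by eventually_elim (metis comp_apply)
  then obtain N where N: "open N" "0 \<in> N" "\<And>x. x \<in> N \<Longrightarrow> x \<in> M \<and> cusp_normal_form (\<sigma> x) \<in> T \<and>
      f x = \<tau>' (cusp_normal_form (\<sigma> x))"
    unfolding eventually_nhds by blast
  have "smooth_on \<sigma> N"
    by (rule smooth_on_subset[OF M(3)]) (use N(3) in auto)
  then show thesis
    by (rule that[of N \<sigma> \<tau>' T, OF N(1,2)]) (use \<sigma>0 M(4) T(3,4) N(3) in auto)
qed

section \<open>The null section and the function \<open>lambda_phi\<close>\<close>

lemma frechet_derivative_compose_smooth_on:
  fixes h :: "real^3 \<Rightarrow> real^2"
  assumes "open N" "smooth_on h N" "smooth_on \<psi> T"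
    and "\<And>x. x \<in> N \<Longrightarrow> h x \<in> T \<and> f x = \<psi> (h x)" and "q \<in> N"
  shows "frechet_derivative f (at q) v = frechet_derivative \<psi> (at (h q)) (frechet_derivative h (at q) v)"
proof -
  have "((\<lambda>x. \<psi> (h x)) has_derivative
      (\<lambda>v. frechet_derivative \<psi> (at (h q)) (frechet_derivative h (at q) v))) (at q)"
    using assms by (blast intro: has_derivative_compose smooth_on_has_derivative)
  then have "(f has_derivative
      (\<lambda>v. frechet_derivative \<psi> (at (h q)) (frechet_derivative h (at q) v))) (at q)"
    by (rule has_derivative_transform_within_open[OF _ assms(1,5)]) (use assms(4) in auto)
  from frechet_derivative_at[OF this] show ?thesis by metis
qed

text \<open>\<open>\<eta>\<close> is the combination of the frame that annihilates the first
  component of \<open>h\<close>, so \<open>dh \<eta>\<close> has only a second component. The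
  determinant of \<open>(dh e1, dh e2)\<close> is the negative of that component, and applying
  \<open>d\<psi>\<close> multiplies it by \<open>det d\<psi>\<close>. As \<open>d\<psi>\<close> is
  injective, \<open>dh \<eta>\<close> vanishes exactly where \<open>lambda_phi\<close> does.\<close>

lemma null_section_on_of_factorization:
  fixes h :: "real^3 \<Rightarrow> real^2"
  assumes N: "open N" and h: "smooth_on h N" and \<psi>: "smooth_on \<psi> T"
    and inj: "\<And>y. y \<in> T \<Longrightarrow> inj (frechet_derivative \<psi> (at y))"
    and f: "\<And>x. x \<in> N \<Longrightarrow> h x \<in> T \<and> f x = \<psi> (h x)"
    and frame: "frame_on N D e1 e2"
  defines "p \<equiv> dir_deriv e1 (\<lambda>x. h x $ 1)" and "r \<equiv> dir_deriv e2 (\<lambda>x. h x $ 1)"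
  defines "\<eta> \<equiv> (\<lambda>x. r x *\<^sub>R e1 x - p x *\<^sub>R e2 x)"
  shows "smooth_on \<eta> N"
    and "\<And>q. q \<in> N \<Longrightarrow> dir_deriv \<eta> (\<lambda>x. h x $ 1) q = 0"
    and "\<And>q. q \<in> N \<Longrightarrow> lambda_phi f e1 e2 q =
      - det (matrix (frechet_derivative \<psi> (at (h q)))) * dir_deriv \<eta> (\<lambda>x. h x $ 2) q"
    and "null_section_on {q \<in> N. p q \<noteq> 0 \<or> r q \<noteq> 0} f D \<eta>"
proof -
  have e: "smooth_on e1 N" "smooth_on e2 N"
    and D: "\<And>q. q \<in> N \<Longrightarrow> D q = span {e1 q, e2 q}"
    using frame unfolding frame_on_def by auto
  have pr: "smooth_on p N" "smooth_on r N"
    unfolding p_def r_def by (intro smooth_on_dir_deriv smooth_on_nth N h e)+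
  show \<eta>s: "smooth_on \<eta> N"
    unfolding \<eta>_def by (intro smooth_on_intros pr e N)
  have lin: "linear (frechet_derivative h (at q))" if "q \<in> N" for q
    using smooth_on_has_derivative[OF h that] has_derivative_linear by blast
  have linL: "linear (frechet_derivative \<psi> (at (h q)))" if "q \<in> N" for q
    using smooth_on_has_derivative[OF \<psi>] f[OF that] has_derivative_linear by blast
  note fh = frechet_derivative_compose_smooth_on[OF N h \<psi> f]
  have p: "p q = dir_deriv e1 h q $ 1" and r: "r q = dir_deriv e2 h q $ 1" if "q \<in> N" for q
    unfolding p_def r_def by (rule dir_deriv_nth[OF h that])+
  have \<eta>h: "dir_deriv \<eta> h q = r q *\<^sub>R dir_deriv e1 h q - p q *\<^sub>R dir_deriv e2 h q"
    if "q \<in> N" for q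
    unfolding dir_deriv_def \<eta>_def
    using lin[OF that] by (simp add: linear_diff linear_scale)
  show \<eta>u: "dir_deriv \<eta> (\<lambda>x. h x $ 1) q = 0" if "q \<in> N" for q
    using \<eta>h p r that by (simp add: dir_deriv_nth[OF h])
  show \<Lambda>: "lambda_phi f e1 e2 q =
      - det (matrix (frechet_derivative \<psi> (at (h q)))) * dir_deriv \<eta> (\<lambda>x. h x $ 2) q"
    if "q \<in> N" for q
  proof -
    have de: "dir_deriv e f q = frechet_derivative \<psi> (at (h q)) (dir_deriv e h q)" for e
      unfolding dir_deriv_def by (rule fh[OF _ that])
    show ?thesis
      unfolding lambda_phi_def de det_columns_linear_image[OF linL[OF that]]
      unfolding det_columns_2 dir_deriv_nth[OF h that] \<eta>h[OF that] p[OF that] r[OF that]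
      by (simp add: algebra_simps)
  qed
  show "null_section_on {q \<in> N. p q \<noteq> 0 \<or> r q \<noteq> 0} f D \<eta>" (is "null_section_on ?W _ _ _")
    unfolding null_section_on_def
  proof (intro conjI ballI impI)
    \<comment> \<open>Writing the condition as a sum of squares makes the set a preimage under a
      single continuous function.\<close>
    have "open {q \<in> N. (p q)\<^sup>2 + (r q)\<^sup>2 \<noteq> 0}"
    proof -
      have "continuous_on N (\<lambda>q. (p q)\<^sup>2 + (r q)\<^sup>2)"
        using pr[THEN smooth_on_isCont] by (intro continuous_intros continuous_at_imp_continuous_on) auto
      from continuous_open_preimage[OF this N, of "- {0}"] show ?thesis
        by (simp add: vimage_def Int_def open_Compl)
    qed
    then show "open ?W" by simp
    show "smooth_on \<eta> ?W" by (rule smooth_on_subset[OF \<eta>s]) auto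
    fix q assume "q \<in> ?W"
    then have q: "q \<in> N" and nz: "p q \<noteq> 0 \<or> r q \<noteq> 0" by auto
    show \<eta>D: "\<eta> q \<in> D q"
      unfolding D[OF q] \<eta>_def by (intro span_diff span_scale span_base) auto
    assume sing: "singular_point f D q"
    let ?L = "frechet_derivative \<psi> (at (h q))"
    have injL: "inj ?L" using f[OF q] inj by blast
    have "linear (frechet_derivative f (at q))"
      using fh[OF _ q] lin[OF q] linL[OF q]
      by (simp add: linear_iff)
    then have "frechet_derivative f (at q) ` D q = span {dir_deriv e1 f q, dir_deriv e2 f q}"
      unfolding D[OF q] dir_deriv_def by (simp add: linear_span_image[symmetric])
    \<comment> \<open>Otherwise the two image vectors would span the plane and the rank would be
      2.\<close>
    then have "lambda_phi f e1 e2 q = 0"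
      using sing dim_span_columns_2 unfolding singular_point_def phi_rank_def lambda_phi_def
      by (metis less_irrefl)
    then have "dir_deriv \<eta> h q = 0"
      using \<Lambda>[OF q] \<eta>u[OF q] det_nz_iff_inj[OF linL[OF q]] injL
      by (simp add: vec_eq_iff forall_2 dir_deriv_nth[OF h q])
    then have \<eta>0: "frechet_derivative f (at q) (\<eta> q) = 0"
      using fh[OF _ q] linL[OF q] by (simp add: dir_deriv_def linear_0)
    show "phi_kernel f D q = span {\<eta> q}"
    proof
      show "span {\<eta> q} \<subseteq> phi_kernel f D q"
      proof
        fix v assume "v \<in> span {\<eta> q}"
        then obtain k where "v = k *\<^sub>R \<eta> q" by (auto simp: span_singleton)
        then show "v \<in> phi_kernel f D q"
          using \<eta>D \<eta>0 \<open>linear (frechet_derivative f (at q))\<close> D[OF q]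
          by (simp add: phi_kernel_def linear_scale span_scale)
      qed
      show "phi_kernel f D q \<subseteq> span {\<eta> q}"
      proof
        fix v assume v: "v \<in> phi_kernel f D q"
        then obtain \<alpha> \<beta> where v': "v = \<alpha> *\<^sub>R e1 q + \<beta> *\<^sub>R e2 q"
          unfolding phi_kernel_def D[OF q] span_2_iff by blast
        have "?L (frechet_derivative h (at q) v) = ?L 0"
          using v fh[OF _ q] linL[OF q] by (simp add: phi_kernel_def linear_0)
        then have "frechet_derivative h (at q) v = 0"
          using injL by (simp add: inj_eq)
        then have \<alpha>\<beta>: "\<alpha> * p q + \<beta> * r q = 0"
          using lin[OF q] p[OF q] r[OF q] unfolding v' dir_deriv_def
          by (simp add: linear_add linear_scale vec_eq_iff forall_2)
        \<comment> \<open>The equation \<open>\<alpha> p + \<beta> r = 0\<close> makes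
          \<open>(\<alpha>, \<beta>)\<close> a multiple of \<open>(r, -p)\<close>; the factor is
          found by dividing by whichever of \<open>p\<close>, \<open>r\<close> is nonzero.\<close>
        have "\<exists>k. v = k *\<^sub>R \<eta> q"
        proof (cases "r q = 0")
          case True
          then have "v = (- \<beta> / p q) *\<^sub>R \<eta> q"
            using nz \<alpha>\<beta> by (simp add: v' \<eta>_def)
          then show ?thesis ..
        next
          case False
          then have "\<beta> = - (\<alpha> / r q) * p q"
            using \<alpha>\<beta> by (simp add: field_simps)
          then have "v = (\<alpha> / r q) *\<^sub>R \<eta> q"
            using False by (simp add: v' \<eta>_def scaleR_diff_right)
          then show ?thesis ..
        qed
        then show "v \<in> span {\<eta> q}" by (auto simp: span_singleton)
      qed
    qed
  qed
qed

theorem mainTheorem4: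
  fixes f :: "real^3 \<Rightarrow> real^2"
    and D1 :: "real^3 \<Rightarrow> (real^3) set"
    and U :: "(real^3) set"
  assumes "smooth_germ f"
    and "cusp_germ f"
    and "0 \<in> U" and "rank2_distribution_on U D1"
    and "phi_rank f D1 0 = 1"
    and "nondegenerate_singular f D1 0"
    and "\<not> fold_like f D1 0"
  shows "cusp_like f D1 0"
proof -
  obtain N' \<sigma> T \<psi> where N': "open N'" "0 \<in> N'" "smooth_on \<sigma> N'" and \<sigma>0: "\<sigma> 0 = 0"
    and \<sigma>inj: "\<And>x. x \<in> N' \<Longrightarrow> inj (frechet_derivative \<sigma> (at x))"
    and \<psi>: "smooth_on \<psi> T" "\<And>y. y \<in> T \<Longrightarrow> inj (frechet_derivative \<psi> (at y))"
    and f': "\<And>x. x \<in> N' \<Longrightarrow> cusp_normal_form (\<sigma> x) \<in> T \<and> f x = \<psi> (cusp_normal_form (\<sigma> x))"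
    by (rule cusp_germ_factorization[OF assms(1,2)]) (rule that)
  obtain V e1 e2 where V: "0 \<in> V" "frame_on V D1 e1 e2"
    using assms(3,4) unfolding rank2_distribution_on_def by blast
  \<comment> \<open>One neighborhood carries both the factorization of \<open>f\<close> and a frame
    of \<open>D1\<close>.\<close>
  define N where "N = N' \<inter> V"
  have N: "open N" "0 \<in> N" and \<sigma>: "smooth_on \<sigma> N" and frame: "frame_on N D1 e1 e2"
    using N' V unfolding N_def frame_on_def by (auto intro: smooth_on_subset)
  have f: "cusp_normal_form (\<sigma> x) \<in> T \<and> f x = \<psi> (cusp_normal_form (\<sigma> x))" if "x \<in> N" for x
    using f' that by (simp add: N_def)
  define h where "h = (\<lambda>x. cusp_normal_form (\<sigma> x))"
  have h: "smooth_on h N"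
    unfolding h_def by (rule smooth_on_compose[OF N(1) _ smooth_on_cusp_normal_form \<sigma>]) simp
  define u v w where "u = (\<lambda>x. \<sigma> x $ 1)" and "v = (\<lambda>x. \<sigma> x $ 2)" and "w = (\<lambda>x. \<sigma> x $ 3)"
  have uvw: "smooth_on u N" "smooth_on v N" "smooth_on w N"
    unfolding u_def v_def w_def by (intro smooth_on_nth N \<sigma>)+
  have uvw0: "u 0 = 0" "v 0 = 0" "w 0 = 0"
    using \<sigma>0 by (simp_all add: u_def v_def w_def)
  have h1: "(\<lambda>x. h x $ 1) = u" and h2: "(\<lambda>x. h x $ 2) = (\<lambda>x. v x ^ 2 + w x ^ 3 + u x * w x)"
    by (simp_all add: h_def u_def v_def w_def cusp_normal_form_nth cusp_height_def)
  define p r where "p = dir_deriv e1 u" and "r = dir_deriv e2 u"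
  define \<eta> where "\<eta> = (\<lambda>x. r x *\<^sub>R e1 x - p x *\<^sub>R e2 x)"
  define c where "c = (\<lambda>q. - det (matrix (frechet_derivative \<psi> (at (h q)))))"
  define W where "W = {q \<in> N. p q \<noteq> 0 \<or> r q \<noteq> 0}"
  have hf: "h x \<in> T \<and> f x = \<psi> (h x)" if "x \<in> N" for x
    using f[OF that] by (simp add: h_def)
  note factored = null_section_on_of_factorization[OF N(1) h \<psi> hf frame,
      unfolded h1 h2, folded p_def r_def, folded \<eta>_def W_def]
  have \<eta>: "smooth_on \<eta> N" and \<eta>u: "\<And>q. q \<in> N \<Longrightarrow> dir_deriv \<eta> u q = 0"
    and \<Lambda>: "\<And>q. q \<in> N \<Longrightarrow> lambda_phi f e1 e2 q =
      c q * dir_deriv \<eta> (\<lambda>x. v x ^ 2 + w x ^ 3 + u x * w x) q"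
    and null: "null_section_on W f D1 \<eta>"
    using factored by (simp_all add: c_def)
  have fh: "frechet_derivative f (at 0) x =
      frechet_derivative \<psi> (at (h 0)) (frechet_derivative h (at 0) x)" for x
    by (rule frechet_derivative_compose_smooth_on[OF N(1) h \<psi>(1) hf N(2)])
  have linL: "linear (frechet_derivative \<psi> (at (h q)))" if "q \<in> N" for q
    using smooth_on_has_derivative[OF \<psi>(1)] hf[OF that] has_derivative_linear by blast
  have e: "e1 0 \<noteq> e2 0" "independent {e1 0, e2 0}" and D0: "D1 0 = span {e1 0, e2 0}"
    using frame N(2) unfolding frame_on_def by auto
  \<comment> \<open>If both frame vectors annihilated \<open>u\<close> at 0, they would also
    annihilate the cusp function there, whose derivative along such vectors vanishes when
    \<open>u = v = w = 0\<close>. Then \<open>df\<close> would kill \<open>D1 0\<close>,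
    contradicting rank one.\<close>
  have pr0: "p 0 \<noteq> 0 \<or> r 0 \<noteq> 0"
  proof (rule ccontr)
    assume "\<not> (p 0 \<noteq> 0 \<or> r 0 \<noteq> 0)"
    then have u0: "dir_deriv e1 u 0 = 0" "dir_deriv e2 u 0 = 0" by (simp_all add: p_def r_def)
    have h0: "dir_deriv e h 0 = 0" if "dir_deriv e u 0 = 0" for e
      using dir_deriv_cusp_function[OF N uvw that] uvw0 that
      by (simp add: vec_eq_iff forall_2 dir_deriv_nth[OF h N(2), symmetric] h1 h2)
    have *: "frechet_derivative f (at 0) (e1 0) = 0" "frechet_derivative f (at 0) (e2 0) = 0"
      using h0[OF u0(1)] h0[OF u0(2)] linL[OF N(2)] by (simp_all add: fh dir_deriv_def linear_0)
    have "linear (frechet_derivative f (at 0))"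
      using fh linL[OF N(2)] smooth_on_has_derivative[OF h N(2), THEN has_derivative_linear]
      by (simp add: linear_iff)
    then have "frechet_derivative f (at 0) ` D1 0 = span {0}"
      unfolding D0 using * by (simp add: linear_span_image[symmetric])
    then show False using assms(5) by (simp add: phi_rank_def)
  qed
  then have W: "0 \<in> W" using N(2) by (simp add: W_def)
  have "smooth_on (\<lambda>x. frechet_derivative \<psi> (at (h x)) b $ i) N" for b i
    by (intro smooth_on_nth N(1)
        smooth_on_compose[OF N(1) _ smooth_on_frechet_derivative[OF \<psi>(1)] h]) (use hf in auto)
  \<comment> \<open>The determinant of \<open>d\<psi>\<close> is written out in the images of the
    two axis vectors, and negation is expressed as a difference from 0.\<close>
  then have "smooth_on (\<lambda>x. 0 -
      (frechet_derivative \<psi> (at (h x)) (axis 1 1) $ 1 * frechet_derivative \<psi> (at (h x)) (axis 2 1) $ 2 -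
       frechet_derivative \<psi> (at (h x)) (axis 2 1) $ 1 * frechet_derivative \<psi> (at (h x)) (axis 1 1) $ 2)) N"
    by (intro smooth_on_const smooth_on_diff smooth_on_mult N(1))
  then have c: "smooth_on c N"
    by (simp add: c_def det_2 matrix_def)
  have c0: "c 0 \<noteq> 0"
    using det_nz_iff_inj[OF linL[OF N(2)]] \<psi>(2) hf[OF N(2)] by (simp add: c_def)
  note deriv = dir_deriv_cusp_multiplier[OF N c uvw \<eta> \<eta>u uvw0 \<Lambda>]
  \<comment> \<open>\<open>fold_like\<close> asks for some frame and some null section, so its
    negation applies to the present pair.\<close>
  have fold: "dir_deriv \<eta> (lambda_phi f e1 e2) 0 = 0"
    using assms(5,7) N(2) frame W null unfolding fold_like_def corank_one_def by blast
  then have v0: "dir_deriv \<eta> v 0 = 0"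
    using deriv(1) c0 by simp
  \<comment> \<open>If \<open>\<eta> w\<close> vanished as well, \<open>d\<sigma>\<close> would send
    \<open>\<eta> 0\<close> to 0; injectivity gives \<open>\<eta> 0 = 0\<close>, against the
    independence of the frame and \<open>pr0\<close>.\<close>
  have w0: "dir_deriv \<eta> w 0 \<noteq> 0"
  proof
    assume "dir_deriv \<eta> w 0 = 0"
    then have "dir_deriv \<eta> \<sigma> 0 = 0"
      using v0 \<eta>u[OF N(2)] unfolding u_def v_def w_def
      by (simp add: vec_eq_iff forall_3 dir_deriv_nth[OF \<sigma> N(2)])
    moreover have "linear (frechet_derivative \<sigma> (at 0))"
      using smooth_on_has_derivative[OF \<sigma> N(2)] has_derivative_linear by blast
    ultimately have "\<eta> 0 = 0"
      using \<sigma>inj[OF N'(2)] by (simp add: dir_deriv_def linear_injective_0)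
    then show False
      using independent_2_scaleR_eq[OF e, of "r 0" "p 0"] pr0 by (simp add: \<eta>_def)
  qed
  have "dir_deriv \<eta> (dir_deriv \<eta> (lambda_phi f e1 e2)) 0 \<noteq> 0"
    using deriv(2) v0 w0 c0 by simp
  then show ?thesis
    unfolding cusp_like_def corank_one_def
    using assms(5,6) N(2) frame W null fold by blast
qed

end
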